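(* Suppose that $S:\mathbb{R}^n\to\mathbb{R}^n$ is nonexpansive and let $\bar\alpha\in(0,1)$. Then every sequence generated by the line search iteration (with nominal step length $\bar\alpha$) satisfies $\|r^k\|_2\to c$ as $k\to\infty$ for some $c\in\mathbb{R}$; that is, the sequence of residual norms $(\|r^k\|_2)_{k\ge 0}$ converges.
   Context: $\|\cdot\|_2$ is the Euclidean norm on $\mathbb{R}^n$. $S$ is nonexpansive if $\|Su-Sv\|_2\le\|u-v\|_2$ for all $u,v\in\mathbb{R}^n$. Line search iteration: fix algorithm parameters $\bar\alpha\in(0,1)$ (nominal step length), $\epsilon\in(0,1)$ and $\alpha^{\max}\ge\bar\alpha$, and an arbitrary starting point $x^0\in\mathbb{R}^n$. For $k=0,1,2,\dots$ set $$r^k:=Sx^k-x^k,\qquad \bar x^k:=x^k+\bar\alpha r^k,\qquad \bar r^k:=S\bar x^k-\bar x^k,\qquad x^{k+1}:=x^k+\alpha_k r^k,$$ where for each $k$ the step length $\alpha_k$ satisfies: either $\alpha_k=\bar\alpha$, or $\alpha_k\in(\bar\alpha,\alpha^{\max}]$ is such that the line search test $\|r^{k+1}\|_2=\|Sx^{k+1}-x^{k+1}\|_2\le(1-\epsilon)\|\bar r^k\|_2$ holds. The choice of $\alpha_k$ is otherwise arbitrary. *)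

theory Defs
  imports "HOL-Analysis.Analysis"
begin

definition nonexpansive :: "(real ^ 'n \<Rightarrow> real ^ 'n) \<Rightarrow> bool" where
  "nonexpansive S \<longleftrightarrow> (\<forall>u v. norm (S u - S v) \<le> norm (u - v))"

definition residual :: "(real ^ 'n \<Rightarrow> real ^ 'n) \<Rightarrow> real ^ 'n \<Rightarrow> real ^ 'n" where
  "residual S x = S x - x"

definition nominal_point :: "(real ^ 'n \<Rightarrow> real ^ 'n) \<Rightarrow> real \<Rightarrow> real ^ 'n \<Rightarrow> real ^ 'n" where
  "nominal_point S \<alpha>bar x = x + \<alpha>bar *\<^sub>R residual S x"

text \<open>The step lengths are an explicit sequence, since their choice is not determined by the
  iterates; the starting point \<open>x 0\<close> is unconstrained.\<close>

definition line_search_iteration ::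
  "(real ^ 'n \<Rightarrow> real ^ 'n) \<Rightarrow> real \<Rightarrow> real \<Rightarrow> real \<Rightarrow>
   (nat \<Rightarrow> real) \<Rightarrow> (nat \<Rightarrow> real ^ 'n) \<Rightarrow> bool" where
  "line_search_iteration S \<alpha>bar \<epsilon> \<alpha>max \<alpha> x \<longleftrightarrow>
     (\<forall>k. x (Suc k) = x k + \<alpha> k *\<^sub>R residual S (x k) \<and>
          (\<alpha> k = \<alpha>bar \<or>
           \<alpha> k \<in> {\<alpha>bar<..\<alpha>max} \<and>
           norm (residual S (x (Suc k)))
             \<le> (1 - \<epsilon>) * norm (residual S (nominal_point S \<alpha>bar (x k)))))"

end

theory Submission
  imports Defs
begin

text \<open>The residual norms never increase, and a decreasing sequence bounded below by \<open>0\<close> converges.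
  They decrease because the nominal step is an averaged (Krasnoselskii--Mann) step, which does not
  increase the residual of a nonexpansive map (\<open>norm_residual_nominal_point_le\<close>); a longer step is
  accepted only if its residual is at most \<open>1 - \<epsilon>\<close> times that of the nominal step, so it inherits
  the bound whatever its length.\<close>

text \<open>Since \<open>nominal_point S a x\<close> divides the segment from \<open>x\<close> to \<open>S x\<close> in the ratio \<open>a : 1 - a\<close>,
  passing through \<open>S x\<close> in the triangle inequality costs \<open>a\<close> times the residual norm (by
  nonexpansiveness) plus \<open>1 - a\<close> times it.\<close>

lemma norm_residual_nominal_point_le:
  assumes "nonexpansive S" and "0 \<le> a" and "a \<le> 1"
  shows "norm (residual S (nominal_point S a x)) \<le> norm (residual S x)"
proof -
  let ?y = "nominal_point S a x"
  have split: "residual S ?y = (S ?y - S x) + (1 - a) *\<^sub>R residual S x"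
    by (simp add: residual_def nominal_point_def algebra_simps)
  have "norm (S ?y - S x) \<le> norm (?y - x)"
    using assms(1) by (simp add: nonexpansive_def)
  also have "\<dots> = a * norm (residual S x)"
    using assms(2) by (simp add: nominal_point_def)
  finally have "norm (residual S ?y) \<le> a * norm (residual S x) + (1 - a) * norm (residual S x)"
    unfolding split using assms(3) by (intro norm_triangle_le) simp
  then show ?thesis
    by (simp add: algebra_simps)
qed

lemma decseq_norm_residual_line_search:
  assumes S: "nonexpansive S"
    and a: "0 \<le> a" "a \<le> 1"
    and e: "0 \<le> e"
    and iter: "line_search_iteration S a e amax \<alpha> x"
  shows "decseq (\<lambda>k. norm (residual S (x k)))"
proof (rule decseq_SucI)
  fix k
  let ?y = "nominal_point S a (x k)"
  have nominal: "norm (residual S ?y) \<le> norm (residual S (x k))"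
    using norm_residual_nominal_point_le[OF S a] .
  have step: "x (Suc k) = x k + \<alpha> k *\<^sub>R residual S (x k)"
    and choice: "\<alpha> k = a \<or> norm (residual S (x (Suc k))) \<le> (1 - e) * norm (residual S ?y)"
    using iter unfolding line_search_iteration_def by blast+
  from choice show "norm (residual S (x (Suc k))) \<le> norm (residual S (x k))"
  proof
    assume "\<alpha> k = a"
    then have "x (Suc k) = ?y"
      using step by (simp add: nominal_point_def)
    then show ?thesis
      using nominal by simp
  next
    assume "norm (residual S (x (Suc k))) \<le> (1 - e) * norm (residual S ?y)"
    also have "\<dots> \<le> norm (residual S ?y)"
      using e by (simp add: algebra_simps)
    finally show ?thesis
      using nominal by simp
  qed
qed

theorem theorem1:
  fixes S :: "real ^ 'n \<Rightarrow> real ^ 'n"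
    and \<alpha>bar \<epsilon> \<alpha>max :: real
    and \<alpha> :: "nat \<Rightarrow> real"
    and x :: "nat \<Rightarrow> real ^ 'n"
  assumes "nonexpansive S"
    and "0 < \<alpha>bar" and "\<alpha>bar < 1"
    and "0 < \<epsilon>" and "\<epsilon> < 1"
    and "\<alpha>bar \<le> \<alpha>max"
    and "line_search_iteration S \<alpha>bar \<epsilon> \<alpha>max \<alpha> x"
  shows "\<exists>c::real. (\<lambda>k. norm (residual S (x k))) \<longlonglongrightarrow> c"
proof -
  have "decseq (\<lambda>k. norm (residual S (x k)))"
    using assms by (intro decseq_norm_residual_line_search) auto
  moreover have "\<forall>k. 0 \<le> norm (residual S (x k))"
    by simp
  ultimately show ?thesis
    by (rule decseq_convergent) blast
qed

end
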